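(* Suppose that $X$ is a random variable. Then the following assertions hold. (i) If $X$ has a bounded density $f_X$, then for all $K\in\mathbb R$, all random variables $\hat X$ and all $0<p<\infty$ we have $$\mathbb E\big|\chi_{[K,\infty)}(X)-\chi_{[K,\infty)}(\hat X)\big|\le 3\,D_X(K)^{\frac{p}{p+1}}\,\|X-\hat X\|_p^{\frac{p}{p+1}},$$ where $$D_X(K):=\frac{1}{d_X(K)}\in(0,\sup f_X].$$ Moreover, the power $\frac{p}{p+1}$ of the $L_p$-norm is optimal, i.e. if $$\mathbb E\big|\chi_{[K,\infty)}(X)-\chi_{[K,\infty)}(\hat X)\big|\le C(X,K,p)\,\|X-\hat X\|_p^{\frac{p}{p+1}}\qquad( * )$$ for all random variables $\hat X$, then the power $\frac{p}{p+1}$ can not be replaced by a power $q$ such that $\frac{p}{p+1}<q<\infty$. (ii) If there exists $p_0>0$ such that the formula $( * )$ holds for all $p_0\le p<\infty$, all $K\in\mathbb R$ and all random variables $\hat X$, and there exists $B_X>0$ such that $C(X,K,p)\le B_X$, then $X$ has a bounded density.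
   Context: $X$ and $\hat X$ are real random variables on a probability space $(\Omega,\mathcal F,\mathbb P)$. $\chi_A$ is the indicator function of $A$, and $\|Z\|_p=(\mathbb E|Z|^p)^{1/p}$ for $0<p<\infty$. The non-increasing rearrangement of $X$ is $X^*:[0,1]\to\mathbb R\cup\{+\infty,-\infty\}$, $X^*(s):=\inf\{c\in\mathbb R:\mathbb P(X>c)\le s\}$, with the convention $\inf\emptyset=\infty$. The minimal slope of $X^*$ from the level $K$ is $d_X:\mathbb R\to[0,\infty)$, $$d_X(K):=\inf_{s\in[0,1],\,s\ne\alpha(K)}\frac{|X^*(s)-K|}{|s-\alpha(K)|},\qquad \alpha(K)=\mathbb P(X\ge K).$$
   Formalization: The optimality of the power p/(p+1) is asserted for almost every level K with respect to the law of X, not for every K: at a level K near which X has no mass, every power q with p/(p+1) < q ≤ p also works. *)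

theory Defs
  imports "HOL-Probability.Probability"
begin

(* Restricting the infimum to real levels c and taking it in ereal gives the stated conventions:
   it is \<infinity> if no level qualifies and -\<infinity> if every level does. *)
definition rearrangement :: "'a measure \<Rightarrow> ('a \<Rightarrow> real) \<Rightarrow> real \<Rightarrow> ereal" where
  "rearrangement M X s = Inf (ereal ` {c. measure M {\<omega> \<in> space M. X \<omega> > c} \<le> s})"

definition upper_prob :: "'a measure \<Rightarrow> ('a \<Rightarrow> real) \<Rightarrow> real \<Rightarrow> real" where
  "upper_prob M X K = measure M {\<omega> \<in> space M. X \<omega> \<ge> K}"

(* The quotients are extended real because the rearrangement may be infinite at the end points
   of [0,1]. Their infimum is finite and nonnegative on a probability space
   (lemma ereal_min_slope), so the conversion to real loses nothing. *)
definition min_slope :: "'a measure \<Rightarrow> ('a \<Rightarrow> real) \<Rightarrow> real \<Rightarrow> real" where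
  "min_slope M X K = real_of_ereal
     (INF s \<in> {0..1} - {upper_prob M X K}.
        \<bar>rearrangement M X s - ereal K\<bar> / ereal \<bar>s - upper_prob M X K\<bar>)"

(* Division by zero is harmless: the theorem asserts inv_min_slope > 0, hence min_slope > 0,
   whenever there is a bounded density. *)
definition inv_min_slope :: "'a measure \<Rightarrow> ('a \<Rightarrow> real) \<Rightarrow> real \<Rightarrow> real" where
  "inv_min_slope M X K = 1 / min_slope M X K"

definition bounded_density :: "'a measure \<Rightarrow> ('a \<Rightarrow> real) \<Rightarrow> (real \<Rightarrow> real) \<Rightarrow> bool" where
  "bounded_density M X f \<longleftrightarrow>
     distributed M lborel X (\<lambda>x. ennreal (f x)) \<and> (\<forall>x. 0 \<le> f x) \<and> bdd_above (range f)"

(* Used only for exponents a > 0. *)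
definition ennreal_powr :: "ennreal \<Rightarrow> real \<Rightarrow> ennreal" where
  "ennreal_powr x a = (if x = \<infinity> then \<infinity> else ennreal (enn2real x powr a))"

(* Extended valued, so that no integrability of Z is required. *)
definition Lp_norm :: "'a measure \<Rightarrow> real \<Rightarrow> ('a \<Rightarrow> real) \<Rightarrow> ennreal" where
  "Lp_norm M p Z = ennreal_powr (\<integral>\<^sup>+ \<omega>. ennreal (\<bar>Z \<omega>\<bar> powr p) \<partial>M) (1 / p)"

definition indicator_error :: "'a measure \<Rightarrow> real \<Rightarrow> ('a \<Rightarrow> real) \<Rightarrow> ('a \<Rightarrow> real) \<Rightarrow> real" where
  "indicator_error M K X Y =
     (\<integral>\<omega>. \<bar>indicator {K..} (X \<omega>) - indicator {K..} (Y \<omega>)\<bar> \<partial>M)"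

lemma ereal_min_slope:
  assumes "prob_space M" "X \<in> borel_measurable M"
  shows "ereal (min_slope M X K) =
     (INF s \<in> {0..1} - {upper_prob M X K}.
        \<bar>rearrangement M X s - ereal K\<bar> / ereal \<bar>s - upper_prob M X K\<bar>)"
    and "0 \<le> min_slope M X K"
proof -
  interpret prob_space M by fact
  note [measurable] = assms(2)
  interpret D: real_distribution "distr M borel X"
    by (rule real_distribution_distr) simp
  let ?a = "upper_prob M X K"
  let ?q = "\<lambda>s. \<bar>rearrangement M X s - ereal K\<bar> / ereal \<bar>s - ?a\<bar>"
  let ?I = "INF s \<in> {0..1} - {?a}. ?q s"
  have tail: "measure M {\<omega> \<in> space M. X \<omega> > c} = 1 - cdf (distr M borel X) c" for c
  proof -
    have "cdf (distr M borel X) c = measure M {\<omega> \<in> space M. \<not> X \<omega> > c}"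
      by (auto simp: cdf_def measure_distr vimage_def Int_def not_less conj_commute
          intro!: arg_cong[where f="measure M"])
    then show ?thesis
      by (subst (asm) prob_neg) auto
  qed
  define s :: real where "s = (if ?a = 1/2 then 1/3 else 1/2)"
  have s: "0 < s" "s < 1" "s \<noteq> ?a" by (auto simp: s_def)
  have "\<forall>\<^sub>F c in at_top. 1 - s < cdf (distr M borel X) c"
    using order_tendstoD(1)[OF D.cdf_lim_at_top_prob, of "1 - s"] s by simp
  then obtain c1 where c1: "1 - s < cdf (distr M borel X) c1"
    by (auto simp: eventually_at_top_linorder)
  have "\<forall>\<^sub>F c in at_bot. cdf (distr M borel X) c < 1 - s"
    using order_tendstoD(2)[OF D.cdf_lim_at_bot, of "1 - s"] s by simp
  then obtain c0 where c0: "\<And>c. c \<le> c0 \<Longrightarrow> cdf (distr M borel X) c < 1 - s"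
    by (auto simp: eventually_at_bot_linorder)
  have "rearrangement M X s \<le> ereal c1"
    unfolding rearrangement_def using c1 by (auto intro!: Inf_lower simp: tail)
  moreover have "ereal c0 \<le> rearrangement M X s"
    unfolding rearrangement_def
  proof (rule Inf_greatest)
    fix y assume "y \<in> ereal ` {c. measure M {\<omega> \<in> space M. X \<omega> > c} \<le> s}"
    then obtain c where "y = ereal c" "1 - cdf (distr M borel X) c \<le> s"
      by (auto simp: tail)
    then show "ereal c0 \<le> y" using c0[of c] by (cases "c \<le> c0") auto
  qed
  ultimately have "\<bar>rearrangement M X s\<bar> \<noteq> \<infinity>" by auto
  then obtain r where "rearrangement M X s = ereal r" by auto
  then have "?q s < \<infinity>" using s(3) by simp
  moreover have "?I \<le> ?q s" by (rule INF_lower) (use s in auto)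
  ultimately have "?I < \<infinity>" by (rule le_less_trans[rotated])
  moreover have nn: "0 \<le> ?I"
  proof (rule INF_greatest)
    fix t assume "t \<in> {0..1} - {?a}"
    then show "0 \<le> ?q t" by (intro zero_le_divide_ereal) auto
  qed
  ultimately show "ereal (min_slope M X K) = ?I"
    unfolding min_slope_def by (subst ereal_real) auto
  show "0 \<le> min_slope M X K"
    unfolding min_slope_def using nn by (rule real_of_ereal_pos)
qed

end

theory Submission
  imports Defs
begin

text \<open>The slope \<open>d\<close> of the rearrangement from the level \<open>K\<close> controls the mass near \<open>K\<close>:
  \<open>d * P(\<bar>X - K\<bar> \<le> t) \<le> 2 * t\<close>. Where the two indicators differ, \<open>\<bar>X - Y\<bar> \<ge> \<bar>X - K\<bar>\<close>, so
  Markov's inequality bounds the error by \<open>2 * t / d + t powr (-p) * E \<bar>X - Y\<bar> powr p\<close>; balancing the two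
  terms in \<open>t\<close> gives the constant 3.

  Conversely, a competitor that flips the indicator exactly on \<open>\<bar>X - K\<bar> \<le> t\<close> at distance at most
  \<open>2 * t\<close> turns an error bound with exponent \<open>q\<close> into \<open>m \<le> C * (2 * t) powr q * m powr (q / p)\<close>
  for \<open>m = P(\<bar>X - K\<bar> \<le> t)\<close>. For \<open>q = p / (p + 1)\<close> this says that \<open>m\<close> is at most linear in \<open>t\<close>,
  with a constant independent of \<open>K\<close>, so the law of \<open>X\<close> is dominated by a multiple of Lebesgue measure.
  For larger \<open>q\<close> it forces \<open>m = o(t)\<close>, and by a Vitali covering argument the levels \<open>K\<close> with this
  property form a null set for an absolutely continuous law.\<close>

section \<open>Rearrangement, minimal slope and the mass near a level\<close>

lemma rearrangement_le:
  "measure M {\<omega> \<in> space M. X \<omega> > c} \<le> s \<Longrightarrow> rearrangement M X s \<le> ereal c"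
  unfolding rearrangement_def by (rule Inf_lower) auto

context prob_space
begin

text \<open>A level \<open>c'\<close> below \<open>c\<close> has tail mass at least
  \<open>upper_prob M X c\<close>, hence above \<open>s\<close>, so it is not admissible in the
  infimum. Together with \<open>rearrangement_le\<close> this brackets the rearrangement.\<close>

lemma le_rearrangement:
  assumes [measurable]: "X \<in> borel_measurable M" and s: "s < upper_prob M X c"
  shows "ereal c \<le> rearrangement M X s"
  unfolding rearrangement_def
proof (rule Inf_greatest)
  fix y assume "y \<in> ereal ` {c. prob {\<omega> \<in> space M. X \<omega> > c} \<le> s}"
  then obtain c' where c': "y = ereal c'" "prob {\<omega> \<in> space M. X \<omega> > c'} \<le> s" by auto
  have "upper_prob M X c \<le> prob {\<omega> \<in> space M. X \<omega> > c'}" if "c' < c"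
    unfolding upper_prob_def using that by (intro finite_measure_mono) auto
  then show "ereal c \<le> y" using c' s by fastforce
qed

text \<open>This is the bound by the infimum with its denominator cleared; the product form also
  covers the excluded point \<open>s = upper_prob M X K\<close>.\<close>

lemma min_slope_mult_le:
  assumes X: "X \<in> borel_measurable M"
    and s: "0 \<le> s" "s \<le> 1"
    and r: "\<bar>rearrangement M X s - ereal K\<bar> \<le> ereal t"
  shows "min_slope M X K * \<bar>s - upper_prob M X K\<bar> \<le> t"
proof (cases "s = upper_prob M X K")
  case True
  have "(0::ereal) \<le> ereal t" using r by (rule order_trans[rotated]) simp
  then show ?thesis using True by simp
next
  case False
  obtain r where r': "\<bar>rearrangement M X s - ereal K\<bar> = ereal r"
    using r by (cases "\<bar>rearrangement M X s - ereal K\<bar>") auto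
  have "ereal (min_slope M X K) \<le> \<bar>rearrangement M X s - ereal K\<bar> / ereal \<bar>s - upper_prob M X K\<bar>"
    unfolding ereal_min_slope(1)[OF prob_space_axioms X] by (rule INF_lower) (use s False in auto)
  then have "min_slope M X K \<le> r / \<bar>s - upper_prob M X K\<bar>"
    using False by (simp add: r')
  then have "min_slope M X K * \<bar>s - upper_prob M X K\<bar> \<le> r"
    using False by (simp add: field_simps)
  then show ?thesis using r r' by simp
qed

lemma abs_ereal_diff_le:
  assumes "ereal (K - t) \<le> x" "x \<le> ereal (K + t)"
  shows "\<bar>x - ereal K\<bar> \<le> ereal t"
  using assms by (cases x) auto

text \<open>The mass within \<open>t\<close> of \<open>K\<close> is
  \<open>(\<beta> - \<alpha>) + (\<alpha> - \<gamma>)\<close>, the part below \<open>K\<close> and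
  the part from \<open>K\<close> upwards. For \<open>s\<close> from \<open>\<gamma>\<close> up to
  but excluding \<open>\<beta>\<close> the rearrangement stays within \<open>t\<close> of
  \<open>K\<close>, so the slope \<open>d\<close> limits each part to \<open>t / d\<close>.\<close>

lemma min_slope_mult_prob_le:
  assumes X [measurable]: "X \<in> borel_measurable M" and t: "0 \<le> t"
  shows "min_slope M X K * prob {\<omega> \<in> space M. \<bar>X \<omega> - K\<bar> \<le> t} \<le> 2 * t"
proof -
  define \<alpha> where "\<alpha> = upper_prob M X K"
  define \<beta> where "\<beta> = upper_prob M X (K - t)"
  define \<gamma> where "\<gamma> = prob {\<omega> \<in> space M. X \<omega> > K + t}"
  define d where "d = min_slope M X K"
  have d: "0 \<le> d" unfolding d_def by (rule ereal_min_slope(2)[OF prob_space_axioms X])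
  have a01: "0 \<le> \<alpha>" "\<alpha> \<le> 1" and b1: "\<beta> \<le> 1" and g01: "0 \<le> \<gamma>" "\<gamma> \<le> 1"
    by (auto simp: \<alpha>_def \<beta>_def \<gamma>_def upper_prob_def)
  have ga: "\<gamma> \<le> \<alpha>" unfolding \<gamma>_def \<alpha>_def upper_prob_def using t by (intro finite_measure_mono) auto
  have ab: "\<alpha> \<le> \<beta>" unfolding \<beta>_def \<alpha>_def upper_prob_def using t by (intro finite_measure_mono) auto
  have right: "d * (\<alpha> - \<gamma>) \<le> t"
  proof (cases "\<gamma> = \<alpha>")
    case False
    then have "ereal K \<le> rearrangement M X \<gamma>"
      using ga by (intro le_rearrangement) (auto simp: \<alpha>_def)
    then have "ereal (K - t) \<le> rearrangement M X \<gamma>"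
      by (rule order_trans[rotated]) (use t in simp)
    moreover have "rearrangement M X \<gamma> \<le> ereal (K + t)" by (rule rearrangement_le) (simp add: \<gamma>_def)
    ultimately have "d * \<bar>\<gamma> - \<alpha>\<bar> \<le> t"
      unfolding d_def \<alpha>_def using g01 by (intro min_slope_mult_le abs_ereal_diff_le X) auto
    then show ?thesis using ga by simp
  qed (use t in simp)
  have left: "d * (\<beta> - \<alpha>) \<le> t"
  proof (cases "d = 0 \<or> \<alpha> = \<beta>")
    case False
    then have d0: "0 < d" and "\<alpha> < \<beta>" using d ab by auto
    \<comment> \<open>The point \<open>s = \<beta>\<close> cannot be used itself: if
      \<open>X\<close> has a gap below \<open>K - t\<close>, the rearrangement there can drop under
      \<open>K - t\<close>. So \<open>s\<close> stays below \<open>\<beta>\<close> and the bound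
      passes to the limit.\<close>
    have "s \<le> \<alpha> + t / d" if s: "\<alpha> < s" "s < \<beta>" for s
    proof -
      have "prob {\<omega> \<in> space M. X \<omega> > K} \<le> \<alpha>"
        unfolding \<alpha>_def upper_prob_def by (intro finite_measure_mono) auto
      then have "rearrangement M X s \<le> ereal K"
        using s by (intro rearrangement_le) simp
      then have "rearrangement M X s \<le> ereal (K + t)"
        by (rule order_trans) (use t in simp)
      moreover have "ereal (K - t) \<le> rearrangement M X s"
        by (rule le_rearrangement) (use s in \<open>auto simp: \<beta>_def\<close>)
      ultimately have "d * \<bar>s - \<alpha>\<bar> \<le> t"
        unfolding d_def \<alpha>_def using s a01 b1 by (intro min_slope_mult_le abs_ereal_diff_le X) auto
      then show ?thesis using s d0 by (simp add: field_simps)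
    qed
    then have "\<beta> \<le> \<alpha> + t / d"
      using dense_le_bounded[OF \<open>\<alpha> < \<beta>\<close>, of "\<alpha> + t / d"] by blast
    then show ?thesis using d0 by (simp add: field_simps)
  qed (use t in auto)
  have "prob {\<omega> \<in> space M. \<bar>X \<omega> - K\<bar> \<le> t} + \<gamma> = \<beta>"
    unfolding \<beta>_def \<gamma>_def upper_prob_def using t
    by (subst finite_measure_Union[symmetric]) (auto intro!: arg_cong[where f=prob])
  then have "prob {\<omega> \<in> space M. \<bar>X \<omega> - K\<bar> \<le> t} = (\<beta> - \<alpha>) + (\<alpha> - \<gamma>)"
    by simp
  then have "d * prob {\<omega> \<in> space M. \<bar>X \<omega> - K\<bar> \<le> t} = d * (\<beta> - \<alpha>) + d * (\<alpha> - \<gamma>)"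
    by (simp only: distrib_left)
  then show ?thesis using left right unfolding d_def by linarith
qed

text \<open>The rearrangement is a generalized inverse of the tail function, so a Lipschitz constant
  \<open>L\<close> of the tail turns into a lower bound \<open>1 / L\<close> on the slope of the
  inverse.\<close>

lemma min_slope_ge:
  assumes X [measurable]: "X \<in> borel_measurable M" and L: "0 < L"
    and lip: "\<And>a b. \<bar>upper_prob M X a - upper_prob M X b\<bar> \<le> L * \<bar>a - b\<bar>"
  shows "1 / L \<le> min_slope M X K"
proof -
  have "ereal (1 / L) \<le> \<bar>rearrangement M X s - ereal K\<bar> / ereal \<bar>s - upper_prob M X K\<bar>"
    if "s \<noteq> upper_prob M X K" for s
  proof (cases "rearrangement M X s")
    case (real r)
    have "\<bar>s - upper_prob M X K\<bar> \<le> L * \<bar>r - K\<bar> + e" if "0 < e" for e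
    \<comment> \<open>The value \<open>r\<close> at \<open>s\<close> only locates \<open>s\<close>
      between the tails at \<open>r + h\<close> and \<open>r - h\<close> for positive
      \<open>h\<close>; this choice makes the loss in the Lipschitz bound equal to
      \<open>e\<close>.\<close>
    proof -
      define h where "h = e / L"
      have h: "0 < h" "L * h = e" using that L by (auto simp: h_def)
      have "s < prob {\<omega> \<in> space M. X \<omega> > r - h}"
        using rearrangement_le[where M=M and X=X and s=s and c="r - h"] h real by (auto simp: not_le[symmetric])
      also have "\<dots> \<le> upper_prob M X (r - h)"
        unfolding upper_prob_def by (intro finite_measure_mono) auto
      finally have 1: "s < upper_prob M X (r - h)" .
      have 2: "upper_prob M X (r + h) \<le> s"
        using le_rearrangement[where X=X and s=s and c="r + h"] h real by (auto simp: not_le[symmetric])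
      have "L * \<bar>r - h - K\<bar> \<le> L * (\<bar>r - K\<bar> + h)" "L * \<bar>K - (r + h)\<bar> \<le> L * (\<bar>r - K\<bar> + h)"
        using L h by (auto intro!: mult_left_mono)
      moreover have "L * (\<bar>r - K\<bar> + h) = L * \<bar>r - K\<bar> + e"
        by (simp add: distrib_left h(2))
      ultimately show ?thesis
        using 1 2 lip[of "r - h" K] lip[of K "r + h"] unfolding abs_le_iff by linarith
    qed
    then have "\<bar>s - upper_prob M X K\<bar> \<le> L * \<bar>r - K\<bar>" by (rule field_le_epsilon)
    then show ?thesis using real that L by (simp add: field_simps)
  \<comment> \<open>An infinite value of the rearrangement gives an infinite quotient.\<close>
  qed (use that in auto)
  then have "ereal (1 / L) \<le> ereal (min_slope M X K)"
    unfolding ereal_min_slope(1)[OF prob_space_axioms X] by (intro INF_greatest) auto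
  then show ?thesis by simp
qed

section \<open>The indicator error: upper bound, and what an assumed bound says about the mass near
  a level\<close>

lemma indicator_error_eq:
  assumes [measurable]: "X \<in> borel_measurable M" "Y \<in> borel_measurable M"
  shows "indicator_error M K X Y = prob {\<omega> \<in> space M. (K \<le> X \<omega>) \<noteq> (K \<le> Y \<omega>)}"
proof -
  have "indicator_error M K X Y =
      (\<integral>\<omega>. indicator {\<omega> \<in> space M. (K \<le> X \<omega>) \<noteq> (K \<le> Y \<omega>)} \<omega> \<partial>M)"
    unfolding indicator_error_def
    by (intro Bochner_Integration.integral_cong) (auto simp: indicator_def)
  then show ?thesis by simp
qed

end

lemma ennreal_powr_Lp_norm:
  assumes "(\<integral>\<^sup>+ \<omega>. ennreal (\<bar>Z \<omega>\<bar> powr p) \<partial>M) = ennreal i" "0 \<le> i"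
  shows "ennreal_powr (Lp_norm M p Z) q = ennreal (i powr (q / p))"
  using assms by (simp add: Lp_norm_def ennreal_powr_def powr_powr)

context prob_space
begin

text \<open>The slope enters through the linear concentration bound \<open>conc\<close>;
  \<open>D\<close> will be \<open>inv_min_slope M X K\<close>, for which
  \<open>min_slope_mult_prob_le\<close> provides it.\<close>

lemma indicator_error_le:
  assumes X [measurable]: "X \<in> borel_measurable M" and Y [measurable]: "Y \<in> borel_measurable M"
    and p: "0 < p" and D: "0 < D"
    and conc: "\<And>t. 0 < t \<Longrightarrow> prob {\<omega> \<in> space M. \<bar>X \<omega> - K\<bar> \<le> t} \<le> 2 * D * t"
  shows "ennreal (indicator_error M K X Y) \<le> ennreal (3 * D powr (p / (p + 1)))
           * ennreal_powr (Lp_norm M p (\<lambda>\<omega>. X \<omega> - Y \<omega>)) (p / (p + 1))"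
proof (cases "\<integral>\<^sup>+ \<omega>. ennreal (\<bar>X \<omega> - Y \<omega>\<bar> powr p) \<partial>M")
  case top
  then show ?thesis
    using D by (simp add: Lp_norm_def ennreal_powr_def ennreal_mult_top)
next
  case (real i)
  define A where "A = {\<omega> \<in> space M. (K \<le> X \<omega>) \<noteq> (K \<le> Y \<omega>)}"
  have markov: "prob A \<le> 2 * D * t + i / t powr p" if t: "0 < t" for t
  proof -
    \<comment> \<open>The event that X and Y are at least \<open>t\<close> apart, in the shape
      expected by the Markov inequality.\<close>
    define B where "B = {\<omega> \<in> space M. 1 \<le> ennreal (1 / t powr p) * ennreal (\<bar>X \<omega> - Y \<omega>\<bar> powr p)}"
    have [measurable]: "B \<in> sets M" unfolding B_def by measurable
    have "emeasure M B \<le> ennreal (1 / t powr p) * (\<integral>\<^sup>+ \<omega>. ennreal (\<bar>X \<omega> - Y \<omega>\<bar> powr p) * indicator (space M) \<omega> \<partial>M)"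
      unfolding B_def by (rule nn_integral_Markov_inequality) auto
    also have "(\<integral>\<^sup>+ \<omega>. ennreal (\<bar>X \<omega> - Y \<omega>\<bar> powr p) * indicator (space M) \<omega> \<partial>M) = ennreal i"
      unfolding real(2)[symmetric] by (intro nn_integral_cong) auto
    also have "ennreal (1 / t powr p) * ennreal i = ennreal (i / t powr p)"
      using real by (simp flip: ennreal_mult')
    finally have PB: "prob B \<le> i / t powr p"
      using real by (simp add: emeasure_eq_measure)
    have "A \<subseteq> {\<omega> \<in> space M. \<bar>X \<omega> - K\<bar> \<le> t} \<union> B"
    proof
      fix \<omega> assume \<omega>: "\<omega> \<in> A"
      show "\<omega> \<in> {\<omega> \<in> space M. \<bar>X \<omega> - K\<bar> \<le> t} \<union> B"
      proof (cases "\<bar>X \<omega> - K\<bar> \<le> t")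
        case False
        then have "t \<le> \<bar>X \<omega> - Y \<omega>\<bar>" using \<omega> by (auto simp: A_def)
        then have "t powr p \<le> \<bar>X \<omega> - Y \<omega>\<bar> powr p" using t p by (intro powr_mono2) auto
        then have "1 \<le> 1 / t powr p * \<bar>X \<omega> - Y \<omega>\<bar> powr p" using t by (simp add: field_simps)
        then have "\<omega> \<in> B" using \<omega> by (simp add: B_def A_def flip: ennreal_mult')
        then show ?thesis by simp
      qed (use \<omega> in \<open>auto simp: A_def\<close>)
    qed
    then have "prob A \<le> prob ({\<omega> \<in> space M. \<bar>X \<omega> - K\<bar> \<le> t} \<union> B)"
      by (intro finite_measure_mono) auto
    also have "\<dots> \<le> prob {\<omega> \<in> space M. \<bar>X \<omega> - K\<bar> \<le> t} + prob B"
      by (rule measure_Un_le) auto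
    finally show ?thesis using conc[OF t] PB by linarith
  qed
  have "prob A \<le> 3 * D powr (p / (p + 1)) * i powr (1 / (p + 1))"
  proof (cases "i = 0")
    case True
    \<comment> \<open>With moment 0 there is no balancing radius; the radius
      \<open>e / (2 * D)\<close> makes the concentration term equal to the arbitrary
      \<open>e\<close>.\<close>
    have "prob A \<le> 0 + e" if "0 < e" for e
      using markov[of "e / (2 * D)"] that D True by simp
    then have "prob A \<le> 0" by (rule field_le_epsilon)
    then show ?thesis by (rule order_trans) simp
  next
    case False
    then have i: "0 < i" using real by simp
    \<comment> \<open>This \<open>t\<close> solves \<open>D * t powr (p + 1) = i\<close>: the Markov
      term becomes \<open>D * t\<close>, and the total is \<open>3 * D * t\<close>.\<close>
    define t where "t = (i / D) powr (1 / (p + 1))"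
    have t: "0 < t" using i D by (simp add: t_def)
    have "D * t = D powr (p / (p + 1)) * i powr (1 / (p + 1))"
    proof -
      have "p / (p + 1) = 1 - 1 / (p + 1)" using p by (simp add: field_simps)
      then have "D powr (p / (p + 1)) = D / D powr (1 / (p + 1))" using D by (simp add: powr_diff)
      then show ?thesis using i D by (simp add: t_def powr_divide)
    qed
    moreover have "i / t powr p = D * t"
    proof -
      have "t * t powr p = t powr (p + 1)" using t by (simp add: powr_add)
      also have "\<dots> = i / D" using i D p by (simp add: t_def powr_powr)
      finally show ?thesis using t D i by (simp add: field_simps)
    qed
    ultimately show ?thesis using markov[OF t] by simp
  qed
  then have "indicator_error M K X Y \<le> (3 * D powr (p / (p + 1))) * i powr (p / (p + 1) / p)"
    using p by (simp add: indicator_error_eq A_def)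
  then show ?thesis
    by (subst ennreal_powr_Lp_norm[OF real(2,1)]) (simp add: flip: ennreal_mult')
qed

text \<open>The assumed bound is tested on one competitor whose p-th moment distance to X is at most
  \<open>(2 * t) powr p * m\<close>. The mass \<open>m\<close> ends up on both sides and is solved
  for later, depending on \<open>q\<close>.\<close>

lemma prob_near_level_le:
  assumes X [measurable]: "X \<in> borel_measurable M" and p: "0 < p" and q: "0 < q" and t: "0 < t"
    and C: "0 \<le> C"
    and bound: "\<And>Y. Y \<in> borel_measurable M \<Longrightarrow> ennreal (indicator_error M K X Y)
              \<le> ennreal C * ennreal_powr (Lp_norm M p (\<lambda>\<omega>. X \<omega> - Y \<omega>)) q"
  defines "m \<equiv> prob {\<omega> \<in> space M. \<bar>X \<omega> - K\<bar> \<le> t}"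
  shows "m \<le> C * (2 * t) powr q * m powr (q / p)"
proof -
  define A where "A = {\<omega> \<in> space M. \<bar>X \<omega> - K\<bar> \<le> t}"
  have [measurable]: "A \<in> sets M" unfolding A_def by measurable
  \<comment> \<open>Values just below \<open>K\<close> are lifted to \<open>K\<close>, at distance
    at most \<open>t\<close>; values in \<open>{K..K + t}\<close> drop to \<open>K - t\<close>,
    strictly below \<open>K\<close>, at distance at most \<open>2 * t\<close>. Elsewhere nothing
    moves, so the error is exactly \<open>m\<close>.\<close>
  define Y where "Y \<omega> = (if \<bar>X \<omega> - K\<bar> \<le> t then if X \<omega> < K then K else K - t else X \<omega>)" for \<omega>
  have Y [measurable]: "Y \<in> borel_measurable M" unfolding Y_def by measurable
  have "{\<omega> \<in> space M. (K \<le> X \<omega>) \<noteq> (K \<le> Y \<omega>)} = A"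
    using t by (auto simp: A_def Y_def)
  then have err: "indicator_error M K X Y = m"
    by (simp add: indicator_error_eq m_def A_def)
  have "(\<integral>\<^sup>+ \<omega>. ennreal (\<bar>X \<omega> - Y \<omega>\<bar> powr p) \<partial>M) \<le> (\<integral>\<^sup>+ \<omega>. ennreal ((2 * t) powr p) * indicator A \<omega> \<partial>M)"
  proof (rule nn_integral_mono)
    fix \<omega> assume "\<omega> \<in> space M"
    moreover have "\<bar>X \<omega> - Y \<omega>\<bar> powr p \<le> (2 * t) powr p" if "\<bar>X \<omega> - K\<bar> \<le> t"
      using that p t by (intro powr_mono2) (auto simp: Y_def)
    ultimately show "ennreal (\<bar>X \<omega> - Y \<omega>\<bar> powr p) \<le> ennreal ((2 * t) powr p) * indicator A \<omega>"
      using p by (auto simp: A_def Y_def indicator_def)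
  qed
  also have "\<dots> = ennreal ((2 * t) powr p * m)"
    by (subst nn_integral_cmult_indicator) (auto simp: emeasure_eq_measure m_def A_def ennreal_mult')
  finally have int: "(\<integral>\<^sup>+ \<omega>. ennreal (\<bar>X \<omega> - Y \<omega>\<bar> powr p) \<partial>M) \<le> ennreal ((2 * t) powr p * m)" .
  then obtain i where i: "0 \<le> i" "(\<integral>\<^sup>+ \<omega>. ennreal (\<bar>X \<omega> - Y \<omega>\<bar> powr p) \<partial>M) = ennreal i"
    by (cases "\<integral>\<^sup>+ \<omega>. ennreal (\<bar>X \<omega> - Y \<omega>\<bar> powr p) \<partial>M") (auto simp: top_unique)
  have m0: "0 \<le> m" by (simp add: m_def)
  have "i \<le> (2 * t) powr p * m" using int i m0 by simp
  then have "i powr (q / p) \<le> ((2 * t) powr p * m) powr (q / p)"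
    using i p q by (intro powr_mono2) auto
  also have "\<dots> = (2 * t) powr q * m powr (q / p)"
    using t p m0 by (simp add: powr_mult powr_powr)
  finally have "C * i powr (q / p) \<le> C * (2 * t) powr q * m powr (q / p)"
    using C by (simp add: mult_left_mono mult.assoc)
  moreover have "ennreal m \<le> ennreal (C * i powr (q / p))"
    using bound[OF Y] by (simp add: err ennreal_powr_Lp_norm[OF i(2,1)] ennreal_mult' C)
  then have "m \<le> C * i powr (q / p)" using C by simp
  ultimately show ?thesis by linarith
qed

text \<open>For \<open>q = p / (p + 1)\<close> the exponents \<open>q\<close> and
  \<open>q / p\<close> add up to 1, so cancelling \<open>m powr (1 / (p + 1))\<close> leaves
  \<open>m\<close> and \<open>2 * t\<close> with the same exponent. The resulting constant does not
  involve \<open>K\<close>.\<close>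

lemma prob_near_level_le_linear:
  assumes X: "X \<in> borel_measurable M" and p: "0 < p" and t: "0 < t" and B: "0 < B"
    and bound: "\<And>Y. Y \<in> borel_measurable M \<Longrightarrow> ennreal (indicator_error M K X Y)
              \<le> ennreal B * ennreal_powr (Lp_norm M p (\<lambda>\<omega>. X \<omega> - Y \<omega>)) (p / (p + 1))"
  shows "prob {\<omega> \<in> space M. \<bar>X \<omega> - K\<bar> \<le> t} \<le> B powr ((p + 1) / p) * (2 * t)"
proof -
  define m where "m = prob {\<omega> \<in> space M. \<bar>X \<omega> - K\<bar> \<le> t}"
  have "m \<le> B * (2 * t) powr (p / (p + 1)) * m powr (p / (p + 1) / p)"
    unfolding m_def by (rule prob_near_level_le) (use assms in auto)
  also have "p / (p + 1) / p = 1 / (p + 1)" using p by simp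
  finally have *: "m \<le> B * (2 * t) powr (p / (p + 1)) * m powr (1 / (p + 1))" .
  have "m \<le> B powr ((p + 1) / p) * (2 * t)"
  proof (cases "m = 0")
    case False
    then have m: "0 < m" by (simp add: m_def zero_less_measure_iff)
    have "p / (p + 1) + 1 / (p + 1) = 1" using p by (simp add: field_simps)
    then have "m powr (p / (p + 1)) * m powr (1 / (p + 1)) = m"
      using m by (simp flip: powr_add)
    with * have "m powr (p / (p + 1)) \<le> B * (2 * t) powr (p / (p + 1))"
      using m by (metis mult_right_le_imp_le powr_gt_zero less_irrefl)
    then have "(m powr (p / (p + 1))) powr ((p + 1) / p) \<le> (B * (2 * t) powr (p / (p + 1))) powr ((p + 1) / p)"
      using p by (intro powr_mono2) auto
    then show ?thesis using p m t B by (simp add: powr_mult powr_powr)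
  qed (use t in simp)
  then show ?thesis by (simp add: m_def)
qed

text \<open>By \<open>conc\<close> the mass near \<open>K\<close> is at least of order
  \<open>t\<close> along arbitrarily small radii. With \<open>m\<close> of order \<open>t\<close>,
  the inequality of \<open>prob_near_level_le\<close> would force \<open>q + q / p \<le> 1\<close>,
  that is, \<open>q \<le> p / (p + 1)\<close>.\<close>

lemma indicator_error_exponent_optimal:
  assumes X: "X \<in> borel_measurable M" and p: "0 < p" and q: "p / (p + 1) < q"
    and c: "0 < c" and conc: "\<And>\<delta>. 0 < \<delta> \<Longrightarrow>
       \<exists>t. 0 < t \<and> t < \<delta> \<and> c * t \<le> prob {\<omega> \<in> space M. \<bar>X \<omega> - K\<bar> \<le> t}"
  shows "\<not> (\<forall>Y \<in> borel_measurable M. ennreal (indicator_error M K X Y)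
              \<le> ennreal C * ennreal_powr (Lp_norm M p (\<lambda>\<omega>. X \<omega> - Y \<omega>)) q)"
proof
  assume bound: "\<forall>Y \<in> borel_measurable M. ennreal (indicator_error M K X Y)
              \<le> ennreal C * ennreal_powr (Lp_norm M p (\<lambda>\<omega>. X \<omega> - Y \<omega>)) q"
  have "0 < p / (p + 1)" using p by simp
  then have q0: "0 < q" using q by linarith
  \<comment> \<open>A negative \<open>C\<close> is read as 0 by \<open>ennreal\<close>; the larger
    \<open>C'\<close> keeps the bound and is positive.\<close>
  define C' where "C' = max C 1"
  have C': "0 < C'" "ennreal C \<le> ennreal C'" by (auto simp: C'_def intro!: ennreal_leI)
  have main: "m \<le> C' * (2 * t) powr q * m powr (q / p)"
    if "0 < t" "m = prob {\<omega> \<in> space M. \<bar>X \<omega> - K\<bar> \<le> t}" for t m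
    unfolding that(2)
  proof (rule prob_near_level_le)
    fix Y :: "'a \<Rightarrow> real" assume "Y \<in> borel_measurable M"
    then have "ennreal (indicator_error M K X Y)
              \<le> ennreal C * ennreal_powr (Lp_norm M p (\<lambda>\<omega>. X \<omega> - Y \<omega>)) q" using bound by blast
    also have "\<dots> \<le> ennreal C' * ennreal_powr (Lp_norm M p (\<lambda>\<omega>. X \<omega> - Y \<omega>)) q"
      using C' by (intro mult_right_mono) auto
    finally show "ennreal (indicator_error M K X Y)
              \<le> ennreal C' * ennreal_powr (Lp_norm M p (\<lambda>\<omega>. X \<omega> - Y \<omega>)) q" .
  qed (use that C' X p q0 in auto)
  have lim: "\<exists>\<delta>>0. \<forall>t. 0 < t \<and> t < \<delta> \<longrightarrow> a * t powr b < e" if "0 < e" "0 < b" for a b e :: real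
  proof -
    have "((\<lambda>t. a * t powr b) \<longlongrightarrow> a * 0 powr b) (at_right 0)"
      using that by (intro tendsto_intros) (auto simp: eventually_at_right_less eventually_at_filter)
    then have "\<forall>\<^sub>F t in at_right 0. a * t powr b < e"
      by (rule order_tendstoD(2)) (use that in simp)
    then show ?thesis by (auto simp: eventually_at_right_field)
  qed
  show False
  proof (cases "p \<le> q")
    \<comment> \<open>Since \<open>m \<le> 1\<close> and \<open>q / p \<ge> 1\<close>,
      \<open>m powr (q / p)\<close> is at most \<open>m\<close>, so \<open>m\<close> cancels and the
      remaining factor tends to 0 with \<open>t\<close>.\<close>
    case True
    obtain \<delta> where \<delta>: "0 < \<delta>" "\<And>t. 0 < t \<Longrightarrow> t < \<delta> \<Longrightarrow> C' * 2 powr q * t powr q < 1"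
      using lim[of 1 q "C' * 2 powr q"] q0 by auto
    obtain t where t: "0 < t" "t < \<delta>" "c * t \<le> prob {\<omega> \<in> space M. \<bar>X \<omega> - K\<bar> \<le> t}"
      using conc[OF \<delta>(1)] by blast
    define m where "m = prob {\<omega> \<in> space M. \<bar>X \<omega> - K\<bar> \<le> t}"
    have "0 < c * t" using c t by simp
    then have m: "0 < m" "m \<le> 1" using t by (auto simp: m_def)
    have "m \<le> C' * (2 * t) powr q * m powr (q / p)" by (rule main) (use t m_def in auto)
    also have "\<dots> \<le> C' * (2 * t) powr q * m powr 1"
      using m p True C' by (intro mult_left_mono powr_mono') auto
    also have "\<dots> < 1 * m"
      using \<delta>(2)[OF t(1,2)] m t by (simp add: powr_mult mult_ac)
    finally show False by simp
  next
    case False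
    \<comment> \<open>Cancelling \<open>m powr (q / p)\<close> and inserting
      \<open>c * t \<le> m\<close> leaves the power \<open>b\<close> of \<open>t\<close>; the
      hypothesis on \<open>q\<close> says exactly that \<open>b\<close> is positive.\<close>
    define b where "b = q - (1 - q / p)"
    have "1 * p < q * (p + 1)" using q p by (simp add: field_simps)
    then have b: "0 < b" using p by (simp add: b_def field_simps)
    define e where "e = c powr (1 - q / p)"
    obtain \<delta> where \<delta>: "0 < \<delta>" "\<And>t. 0 < t \<Longrightarrow> t < \<delta> \<Longrightarrow> C' * 2 powr q * t powr b < e"
      using lim[of e b "C' * 2 powr q"] b c by (auto simp: e_def)
    obtain t where t: "0 < t" "t < \<delta>" "c * t \<le> prob {\<omega> \<in> space M. \<bar>X \<omega> - K\<bar> \<le> t}"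
      using conc[OF \<delta>(1)] by blast
    define m where "m = prob {\<omega> \<in> space M. \<bar>X \<omega> - K\<bar> \<le> t}"
    have "0 < c * t" using c t by simp
    then have m: "0 < m" "c * t \<le> m" using t by (auto simp: m_def)
    have "m powr (1 - q / p) * m powr (q / p) = m" using m by (simp flip: powr_add)
    moreover have "m \<le> C' * (2 * t) powr q * m powr (q / p)" by (rule main) (use t m_def in auto)
    ultimately have 1: "m powr (1 - q / p) \<le> C' * (2 * t) powr q"
      using m by (metis mult_right_le_imp_le powr_gt_zero less_irrefl)
    have "e * t powr (1 - q / p) = (c * t) powr (1 - q / p)"
      using c t by (simp add: e_def powr_mult)
    also have "\<dots> \<le> m powr (1 - q / p)"
      using m \<open>0 < c * t\<close> False p by (intro powr_mono2) auto
    also have "\<dots> \<le> C' * 2 powr q * t powr b * t powr (1 - q / p)"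
      using 1 t by (simp add: powr_mult mult.assoc b_def flip: powr_add)
    also have "\<dots> < e * t powr (1 - q / p)"
      using \<delta>(2)[OF t(1,2)] t by simp
    finally show False by simp
  qed
qed

end

section \<open>Points with little mass nearby, by Vitali covering\<close>

text \<open>Exceptional points in a bounded region are covered, up to a Lebesgue null set, by
  disjoint balls whose \<open>N\<close>-mass is a small multiple of their length. Their total mass
  is therefore small, and absolute continuity disposes of the remainder.\<close>

lemma AE_not_thin:
  fixes N :: "real measure"
  assumes sets [measurable_cong, simp]: "sets N = sets borel"
    and ac: "absolutely_continuous lborel N"
  shows "AE x in N. \<exists>c>0. \<forall>\<delta>>0. \<exists>t. 0 < t \<and> t < \<delta> \<and> ennreal (c * t) \<le> emeasure N (cball x t)"
proof -
  \<comment> \<open>\<open>S\<close> holds the points where the mass of the ball of radius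
    \<open>t\<close> is o(t). Its measurability is not established, so it is enclosed in measurable
    sets \<open>B\<close>.\<close>
  define S where "S = {x. \<forall>c>0. \<exists>\<delta>>0. \<forall>t. 0 < t \<and> t < \<delta> \<longrightarrow> emeasure N (cball x t) < ennreal (c * t)}"
  have cover: "\<exists>B\<in>sets N. S \<inter> cball 0 (real n) \<subseteq> B \<and> emeasure N B \<le> ennreal e" if e: "0 < e" for n e
  proof -
    \<comment> \<open>Chosen so that \<open>c / 2\<close> times the length
      \<open>2 * (real n + 1)\<close> of the enlarged ball is \<open>e\<close>.\<close>
    define c where "c = e / (real n + 1)"
    have c: "0 < c" using e by (simp add: c_def)
    \<comment> \<open>Radii below 1 keep every ball inside
      \<open>cball 0 (real n + 1)\<close>.\<close>
    define I where "I = {(x, t). x \<in> S \<inter> cball 0 (real n) \<and> 0 < t \<and> t < 1 \<and> emeasure N (cball x t) < ennreal (c * t)}"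
    define W where "W i = cball (fst i) (snd i)" for i :: "real \<times> real"
    have [measurable]: "W i \<in> sets borel" for i by (simp add: W_def)
    have pos: "0 < snd i" if "i \<in> I" for i using that by (auto simp: I_def)
    have fine: "\<exists>i. i \<in> I \<and> x \<in> cball (fst i) (snd i) \<and> snd i < d" if "x \<in> S \<inter> cball 0 (real n)" "0 < d" for x d
    proof -
      have "\<exists>\<delta>>0. \<forall>t. 0 < t \<and> t < \<delta> \<longrightarrow> emeasure N (cball x t) < ennreal (c * t)"
        using that c by (auto simp: S_def)
      then obtain \<delta> where \<delta>: "\<delta> > 0" "\<And>t. 0 < t \<Longrightarrow> t < \<delta> \<Longrightarrow> emeasure N (cball x t) < ennreal (c * t)"
        by blast
      define t where "t = min (min d \<delta>) 1 / 2"
      have "0 < t" "t < d" "t < \<delta>" "t < 1" using that(2) \<delta>(1) by (auto simp: t_def)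
      then show ?thesis
        using that \<delta>(2) by (intro exI[of _ "(x, t)"]) (auto simp: I_def)
    qed
    obtain C where C: "countable C" "C \<subseteq> I"
        "pairwise (\<lambda>i j. disjnt (cball (fst i) (snd i)) (cball (fst j) (snd j))) C"
        "negligible (S \<inter> cball 0 (real n) - (\<Union>i\<in>C. cball (fst i) (snd i)))"
      by (rule Vitali_covering_theorem_cballs[of I snd "S \<inter> cball 0 (real n)" fst, OF pos fine])
    have disj: "disjoint_family_on W C"
      using C(3) by (auto simp: disjoint_family_on_def pairwise_def disjnt_def W_def)
    \<comment> \<open>The remainder is null for the completed measure; a Borel null set around it
      lets absolute continuity apply.\<close>
    obtain Z where Z: "Z \<in> null_sets lborel" "S \<inter> cball 0 (real n) - (\<Union>i\<in>C. W i) \<subseteq> Z"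
      using C(4) by (auto simp: negligible_iff_null_sets null_sets_completion_iff2 W_def)
    have ZN: "Z \<in> null_sets N" using Z ac by (auto simp: absolutely_continuous_def)
    have half: "emeasure N (W i) \<le> ennreal (c / 2) * emeasure lborel (W i)" if "i \<in> C" for i
    proof -
      have i: "i \<in> I" using that C by auto
      then have "emeasure N (W i) \<le> ennreal (c * snd i)"
        by (auto simp: I_def W_def intro: less_imp_le)
      also have "\<dots> = ennreal (c / 2) * emeasure lborel (W i)"
        using i c by (auto simp: I_def W_def cball_eq_atLeastAtMost simp flip: ennreal_mult')
      finally show ?thesis .
    qed
    have "emeasure N (\<Union>i\<in>C. W i) = (\<integral>\<^sup>+ i. emeasure N (W i) \<partial>count_space C)"
      using C disj by (intro emeasure_UN_countable) auto
    also have "\<dots> \<le> (\<integral>\<^sup>+ i. ennreal (c / 2) * emeasure lborel (W i) \<partial>count_space C)"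
      using half by (intro nn_integral_mono) auto
    also have "\<dots> = ennreal (c / 2) * emeasure lborel (\<Union>i\<in>C. W i)"
      using C disj by (subst emeasure_UN_countable) (auto simp: nn_integral_cmult)
    also have "\<dots> \<le> ennreal (c / 2) * emeasure lborel (cball (0::real) (real n + 1))"
    proof (intro mult_left_mono emeasure_mono)
      show "(\<Union>i\<in>C. W i) \<subseteq> cball 0 (real n + 1)"
        using C(2) by (fastforce simp: I_def W_def dist_real_def)
    qed auto
    also have "emeasure lborel (cball (0::real) (real n + 1)) = ennreal (2 * (real n + 1))"
      by (simp add: cball_eq_atLeastAtMost)
    also have "ennreal (c / 2) * ennreal (2 * (real n + 1)) = ennreal e"
      using e c by (subst ennreal_mult'[symmetric]) (auto simp: c_def divide_simps)
    finally have "emeasure N ((\<Union>i\<in>C. W i) \<union> Z) \<le> ennreal e"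
      using ZN C(1) by (subst emeasure_Un_null_set) auto
    moreover have "(\<Union>i\<in>C. W i) \<union> Z \<in> sets N"
      using C(1) ZN by (intro sets.Un sets.countable_UN') auto
    moreover have "S \<inter> cball 0 (real n) \<subseteq> (\<Union>i\<in>C. W i) \<union> Z" using Z by auto
    ultimately show ?thesis by blast
  qed
  have "\<exists>B\<in>null_sets N. S \<inter> cball 0 (real n) \<subseteq> B" for n
  proof -
    obtain B where B: "\<And>k. B k \<in> sets N" "\<And>k. S \<inter> cball 0 (real n) \<subseteq> B k"
        "\<And>k. emeasure N (B k) \<le> ennreal (1 / real (Suc k))"
      using cover[of "1 / real (Suc k)" n for k] by atomize_elim (simp del: of_nat_Suc, metis)
    have "emeasure N (\<Inter>k. B k) \<le> ennreal 0"
    proof (rule LIMSEQ_le_const)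
      show "(\<lambda>k. ennreal (1 / real (Suc k))) \<longlonglongrightarrow> ennreal 0"
        by (intro tendsto_ennrealI LIMSEQ_Suc lim_1_over_n)
      have "emeasure N (\<Inter>k. B k) \<le> ennreal (1 / real (Suc k))" for k
        using B(1) by (intro order_trans[OF emeasure_mono B(3)]) auto
      then show "\<exists>m. \<forall>k\<ge>m. emeasure N (\<Inter>k. B k) \<le> ennreal (1 / real (Suc k))" by blast
    qed
    then have "(\<Inter>k. B k) \<in> null_sets N" using B(1) by (intro null_setsI) auto
    moreover have "S \<inter> cball 0 (real n) \<subseteq> (\<Inter>k. B k)" using B by blast
    ultimately show ?thesis by blast
  qed
  then obtain B where B: "\<And>n. B n \<in> null_sets N" "\<And>n. S \<inter> cball 0 (real n) \<subseteq> B n" by metis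
  have "(\<Union>n. B n) \<in> null_sets N" using B by (intro null_sets_UN) auto
  moreover have "S \<subseteq> (\<Union>n. B n)"
  proof
    fix x assume "x \<in> S"
    moreover obtain n where "\<bar>x\<bar> \<le> real n" using real_arch_simple by blast
    ultimately show "x \<in> (\<Union>n. B n)" using B(2)[of n] by (auto simp: dist_real_def)
  qed
  moreover have "{x \<in> space N. \<not> (\<exists>c>0. \<forall>\<delta>>0. \<exists>t. 0 < t \<and> t < \<delta> \<and> ennreal (c * t) \<le> emeasure N (cball x t))} \<subseteq> S"
    unfolding S_def not_le[symmetric] by blast
  ultimately show ?thesis by (intro AE_I'[of "\<Union>n. B n"]) blast+
qed

section \<open>From a linear bound on intervals to a bounded density\<close>

text \<open>A bounded Borel set is covered by countably many non-overlapping intervals of total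
  length close to its measure, and the interval bound is summed. General sets are exhausted by
  bounded ones.\<close>

lemma emeasure_le_lborel:
  fixes N :: "real measure"
  assumes sets [measurable_cong, simp]: "sets N = sets borel" and L: "0 \<le> L"
    and Icc: "\<And>a b. a \<le> b \<Longrightarrow> emeasure N {a..b} \<le> ennreal (L * (b - a))"
    and A: "A \<in> sets borel"
  shows "emeasure N A \<le> ennreal L * emeasure lborel A"
proof -
  have point: "{x} \<in> null_sets N" for x
    using Icc[of x x] by (intro null_setsI) auto
  have bounded: "emeasure N B \<le> ennreal L * emeasure lborel B"
    if B: "B \<in> sets borel" "B \<subseteq> cbox a b" for B a b
  proof -
    have "emeasure lborel B \<le> emeasure lborel (cbox a b)" using B by (intro emeasure_mono) auto
    then have fin: "emeasure lborel B < \<infinity>" by (rule le_less_trans) (simp add: emeasure_lborel_Icc_eq)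
    then have lm: "B \<in> lmeasurable" using B by (auto simp: fmeasurable_def)
    have "emeasure N B \<le> ennreal L * emeasure lborel B + ennreal e" if e: "0 < e" for e
    proof -
      \<comment> \<open>The denominator \<open>L + 1\<close> also works for
        \<open>L = 0\<close>.\<close>
      define h where "h = e / (L + 1)"
      have h: "0 < h" "L * h \<le> e" using L e by (auto simp: h_def field_simps)
      obtain \<D> where D: "countable \<D>" "\<And>K. K \<in> \<D> \<Longrightarrow> K \<subseteq> cbox a b \<and> K \<noteq> {} \<and> (\<exists>c d. K = cbox c d)"
        "pairwise (\<lambda>A B. interior A \<inter> interior B = {}) \<D>"
        "B \<subseteq> \<Union>\<D>" "\<Union>\<D> \<in> lmeasurable" "measure lebesgue (\<Union>\<D>) \<le> measure lebesgue B + h"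
        using measurable_outer_intervals_bounded[OF lm B(2) h(1)] by metis
      \<comment> \<open>Only the interiors of the intervals are disjoint. The end points, collected
        in \<open>E\<close>, carry no \<open>N\<close>-mass, so additivity can be applied to the
        interiors.\<close>
      define E where "E = (\<Union>K\<in>\<D>. K - interior K)"
      have "K - interior K \<in> null_sets N" if K: "K \<in> \<D>" for K
      proof -
        obtain c d where "K = {c..d}" "c \<le> d" using D(2)[OF K] by auto
        then have "K - interior K = {c} \<union> {d}" by (auto simp: interior_atLeastAtMost_real)
        then show ?thesis using null_sets.Un[OF point point] by metis
      qed
      then have E: "E \<in> null_sets N" unfolding E_def using D(1) by (intro null_sets_UN') auto
      have disj: "disjoint_family_on interior \<D>"
        using D(3) by (auto simp: disjoint_family_on_def pairwise_def)
      have int: "emeasure N (interior K) \<le> ennreal L * emeasure lborel (interior K)" if K: "K \<in> \<D>" for K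
      proof -
        obtain c d where cd: "K = {c..d}" "c \<le> d" using D(2)[OF K] by auto
        have "emeasure N (interior K) \<le> emeasure N {c..d}"
          using cd interior_subset by (intro emeasure_mono) auto
        also have "\<dots> \<le> ennreal (L * (d - c))" by (rule Icc[OF cd(2)])
        also have "\<dots> = ennreal L * emeasure lborel (interior K)"
          using cd L by (simp add: interior_atLeastAtMost_real ennreal_mult)
        finally show ?thesis .
      qed
      have U [measurable]: "(\<Union>K\<in>\<D>. interior K) \<in> sets borel"
        by (intro borel_open open_UN) auto
      have "B \<subseteq> (\<Union>K\<in>\<D>. interior K) \<union> E" using D(4) by (auto simp: E_def)
      then have "emeasure N B \<le> emeasure N ((\<Union>K\<in>\<D>. interior K) \<union> E)"
        using E by (intro emeasure_mono sets.Un) (use U in auto)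
      also have "\<dots> = emeasure N (\<Union>K\<in>\<D>. interior K)"
        by (rule emeasure_Un_null_set[OF _ E]) (use U in simp)
      also have "\<dots> = (\<integral>\<^sup>+ K. emeasure N (interior K) \<partial>count_space \<D>)"
        using D(1) disj by (intro emeasure_UN_countable) auto
      also have "\<dots> \<le> (\<integral>\<^sup>+ K. ennreal L * emeasure lborel (interior K) \<partial>count_space \<D>)"
        using int by (intro nn_integral_mono) auto
      also have "\<dots> = ennreal L * emeasure lborel (\<Union>K\<in>\<D>. interior K)"
        using D(1) disj by (subst emeasure_UN_countable) (auto simp: nn_integral_cmult)
      also have "emeasure lborel (\<Union>K\<in>\<D>. interior K) = emeasure lebesgue (\<Union>K\<in>\<D>. interior K)"
        by (subst emeasure_completion) auto
      also have "\<dots> \<le> emeasure lebesgue (\<Union>\<D>)"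
        using D(5) interior_subset by (intro emeasure_mono) (auto simp: fmeasurableD)
      also have "\<dots> \<le> emeasure lborel B + ennreal h"
      proof -
        have "emeasure lebesgue (\<Union>\<D>) = ennreal (measure lebesgue (\<Union>\<D>))"
          using D(5) by (simp add: emeasure_eq_measure2)
        also have "\<dots> \<le> ennreal (measure lebesgue B + h)" using D(6) by (rule ennreal_leI)
        also have "\<dots> = emeasure lebesgue B + ennreal h"
          using h lm by (simp add: emeasure_eq_measure2)
        finally show ?thesis using B by simp
      qed
      also have "ennreal L * (emeasure lborel B + ennreal h) \<le> ennreal L * emeasure lborel B + ennreal e"
        using h L by (auto simp: distrib_left simp flip: ennreal_mult' intro!: add_left_mono ennreal_leI)
      finally show ?thesis by (auto simp: mult_left_mono)
    qed
    then show ?thesis by (rule ennreal_le_epsilon)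
  qed
  define B where "B n = A \<inter> cbox (- real n) (real n)" for n
  have B: "range B \<subseteq> sets borel" "incseq B"
    using A by (auto simp: B_def incseq_def)
  have "(\<Union>n. B n) = A"
  proof -
    have "\<exists>n. - real n \<le> x \<and> x \<le> real n" for x
      using real_arch_simple[of "\<bar>x\<bar>"] by (metis abs_le_iff minus_le_iff)
    then show ?thesis by (auto simp: B_def)
  qed
  then have "emeasure N A = (SUP n. emeasure N (B n))"
    using B by (subst SUP_emeasure_incseq) auto
  also have "\<dots> \<le> ennreal L * emeasure lborel A"
  proof (rule SUP_least)
    fix n
    have "emeasure N (B n) \<le> ennreal L * emeasure lborel (B n)"
      using B(1) by (intro bounded) (auto simp: B_def)
    also have "\<dots> \<le> ennreal L * emeasure lborel A"
      using A by (intro mult_left_mono emeasure_mono) (auto simp: B_def)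
    finally show "emeasure N (B n) \<le> ennreal L * emeasure lborel A" .
  qed
  finally show ?thesis .
qed

text \<open>The Radon-Nikodym density has averages at most \<open>L\<close> over sets of positive
  finite measure, hence is at most \<open>L\<close> almost everywhere.\<close>

lemma ex_bounded_density:
  fixes N :: "real measure"
  assumes fin: "finite_measure N" and sets [measurable_cong, simp]: "sets N = sets borel" and L: "0 \<le> L"
    and le: "\<And>A. A \<in> sets borel \<Longrightarrow> emeasure N A \<le> ennreal L * emeasure lborel A"
  shows "\<exists>f \<in> borel_measurable borel. (\<forall>x. 0 \<le> f x \<and> f x \<le> L) \<and> N = density lborel (\<lambda>x. ennreal (f x))"
proof -
  interpret N: finite_measure N by fact
  have "absolutely_continuous lborel N"
    unfolding absolutely_continuous_def using le by (auto simp: null_sets_def) (metis le mult_zero_right le_zero_eq)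
  then obtain g where g [measurable]: "g \<in> borel_measurable lborel" and N: "density lborel g = N"
    using sigma_finite_measure.Radon_Nikodym[OF sigma_finite_lborel, of N] by auto
  have gA: "(\<integral>\<^sup>+ x. g x * indicator A x \<partial>lborel) = emeasure N A" if "A \<in> sets borel" for A
    using that by (simp flip: N add: emeasure_density)
  have "(\<integral>\<^sup>+ x. g x \<partial>lborel) < \<infinity>"
    using gA[of UNIV] N.emeasure_finite[of UNIV] by (simp add: less_top[symmetric])
  then have "AE x in lborel. g x \<noteq> \<infinity>" by (intro nn_integral_PInf_AE) auto
  then have gr: "AE x in lborel. ennreal (enn2real (g x)) = g x" by eventually_elim (auto simp: less_top)
  define r where "r x = enn2real (g x)" for x
  have [measurable]: "r \<in> borel_measurable borel" unfolding r_def by measurable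
  have rA: "(\<integral>\<^sup>+ x. ennreal (r x) * indicator A x \<partial>lborel) = emeasure N A" if "A \<in> sets borel" for A
    using gA[OF that] gr by (subst nn_integral_cong_AE[where v="\<lambda>x. g x * indicator A x"]) (auto simp: r_def)
  have r0: "0 \<le> r x" for x by (simp add: r_def)
  have int: "integrable lborel r"
    using rA[of UNIV] N.emeasure_finite[of UNIV] by (intro integrableI_nonneg) (auto simp: r0 less_top[symmetric])
  have "AE x in lborel. r x \<in> {..L}"
  proof (rule sigma_finite_measure.averaging_theorem[OF sigma_finite_lborel int])
    fix A :: "real set" assume A: "A \<in> sets lborel" "0 < measure lborel A"
    have "(\<integral>x. indicator A x * r x \<partial>lborel) = enn2real (emeasure N A)"
      using A rA[of A] r0 by (subst integral_eq_nn_integral)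
        (auto simp: ennreal_mult' ennreal_indicator mult.commute)
    also have "\<dots> \<le> L * measure lborel A"
    proof -
      have "emeasure lborel A \<noteq> \<infinity>" using A(2) by (auto simp: measure_def)
      then have "emeasure lborel A = ennreal (measure lborel A)" by (intro emeasure_eq_ennreal_measure) simp
      then have "emeasure N A \<le> ennreal (L * measure lborel A)"
        using le[of A] A L by (simp add: ennreal_mult)
      then show ?thesis using L by (intro enn2real_leI) auto
    qed
    finally show "(1 / measure lborel A) *\<^sub>R set_lebesgue_integral lborel A r \<in> {..L}"
      using A by (simp add: set_lebesgue_integral_def field_simps)
  qed simp
  \<comment> \<open>Truncation at \<open>L\<close> changes the density on a null set and makes the
    bound hold at every point.\<close>
  then have "AE x in lborel. g x = ennreal (min (r x) L)"
    using gr by eventually_elim (auto simp: r_def min_def)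
  then have "density lborel g = density lborel (\<lambda>x. ennreal (min (r x) L))"
    by (intro density_cong) auto
  then show ?thesis
    using r0 L N by (intro bexI[of _ "\<lambda>x. min (r x) L"]) auto
qed

section \<open>Error bound, optimality of the exponent, and the converse\<close>

text \<open>Optimality is stated for almost every \<open>K\<close> under the law of
  \<open>X\<close>, since it fails off the support: if \<open>X\<close> keeps a positive distance
  from \<open>K\<close>, the Markov inequality gives the bound with \<open>q = p\<close>, which
  exceeds \<open>p / (p + 1)\<close>. One null set serves all \<open>p\<close> and \<open>q\<close>,
  because it depends only on the mass near \<open>K\<close>.\<close>

theorem theorem3p4:
  fixes M :: "'a measure" and X :: "'a \<Rightarrow> real"
  assumes "prob_space M" and "X \<in> borel_measurable M"
  shows
    "(\<forall>f. bounded_density M X f \<longrightarrow>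
        (\<forall>K. 0 < inv_min_slope M X K \<and> inv_min_slope M X K \<le> (SUP x. f x)) \<and>
        (\<forall>K. \<forall>Y \<in> borel_measurable M. \<forall>p>0.
           ennreal (indicator_error M K X Y)
             \<le> ennreal (3 * inv_min_slope M X K powr (p / (p + 1)))
               * ennreal_powr (Lp_norm M p (\<lambda>\<omega>. X \<omega> - Y \<omega>)) (p / (p + 1))) \<and>
        (AE K in distr M borel X. \<forall>p>0. \<forall>q>p / (p + 1).
           \<not> (\<exists>C::real. \<forall>Y \<in> borel_measurable M.
                ennreal (indicator_error M K X Y)
                  \<le> ennreal C * ennreal_powr (Lp_norm M p (\<lambda>\<omega>. X \<omega> - Y \<omega>)) q)))
     \<and>
     ((\<exists>p0>0. \<exists>(C :: real \<Rightarrow> real \<Rightarrow> real). \<exists>B>0. \<forall>p\<ge>p0. \<forall>K.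
         C K p \<le> B \<and>
         (\<forall>Y \<in> borel_measurable M.
            ennreal (indicator_error M K X Y)
              \<le> ennreal (C K p) * ennreal_powr (Lp_norm M p (\<lambda>\<omega>. X \<omega> - Y \<omega>)) (p / (p + 1))))
      \<longrightarrow> (\<exists>f. bounded_density M X f))"
\<comment> \<open>The rotation brings the converse, assertion (ii), first.\<close>
proof (intro conjI[rotated] impI allI)
  interpret prob_space M by fact
  note X [measurable] = assms(2)
  assume "\<exists>p0>0. \<exists>(C :: real \<Rightarrow> real \<Rightarrow> real). \<exists>B>0. \<forall>p\<ge>p0. \<forall>K.
         C K p \<le> B \<and>
         (\<forall>Y \<in> borel_measurable M.
            ennreal (indicator_error M K X Y)
              \<le> ennreal (C K p) * ennreal_powr (Lp_norm M p (\<lambda>\<omega>. X \<omega> - Y \<omega>)) (p / (p + 1)))"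
  then obtain p :: real and C :: "real \<Rightarrow> real \<Rightarrow> real" and B :: real where p: "0 < p" "0 < B" "\<And>K. C K p \<le> B"
    and bnd: "\<And>K Y. Y \<in> borel_measurable M \<Longrightarrow> ennreal (indicator_error M K X Y)
              \<le> ennreal (C K p) * ennreal_powr (Lp_norm M p (\<lambda>\<omega>. X \<omega> - Y \<omega>)) (p / (p + 1))"
    by (metis order_refl)
  define N where "N = distr M borel X"
  interpret N: prob_space N unfolding N_def by (rule prob_space_distr) simp
  have sN [measurable_cong, simp]: "sets N = sets borel" by (simp add: N_def)
  define L where "L = B powr ((p + 1) / p)"
  have lin: "prob {\<omega> \<in> space M. \<bar>X \<omega> - K\<bar> \<le> t} \<le> L * (2 * t)" if "0 < t" for K t
    unfolding L_def
  proof (rule prob_near_level_le_linear)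
    fix Y :: "'a \<Rightarrow> real" assume "Y \<in> borel_measurable M"
    then have "ennreal (indicator_error M K X Y)
              \<le> ennreal (C K p) * ennreal_powr (Lp_norm M p (\<lambda>\<omega>. X \<omega> - Y \<omega>)) (p / (p + 1))" by (rule bnd)
    also have "\<dots> \<le> ennreal B * ennreal_powr (Lp_norm M p (\<lambda>\<omega>. X \<omega> - Y \<omega>)) (p / (p + 1))"
      using p by (intro mult_right_mono ennreal_leI) auto
    finally show "ennreal (indicator_error M K X Y)
              \<le> ennreal B * ennreal_powr (Lp_norm M p (\<lambda>\<omega>. X \<omega> - Y \<omega>)) (p / (p + 1))" .
  qed (use that p X in auto)
  have "emeasure N {a..b} \<le> ennreal (L * (b - a))" if "a \<le> b" for a b
  proof -
    have "prob {\<omega> \<in> space M. a \<le> X \<omega> \<and> X \<omega> \<le> b} \<le> L * (b - a) + e" if "0 < e" for e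
    proof -
      have L1: "0 < L + 1" by (simp add: L_def add_nonneg_pos)
      \<comment> \<open>The extra radius keeps \<open>t\<close> positive when \<open>a = b\<close>,
        at a cost of at most \<open>e\<close> in the bound.\<close>
      define u where "u = e / (2 * (L + 1))"
      define t where "t = (b - a) / 2 + u"
      have u: "0 < u" "2 * L * u \<le> e" using that L1 by (auto simp: u_def field_simps)
      have t: "0 < t" "(b - a) / 2 \<le> t"
        unfolding t_def using \<open>a \<le> b\<close> u by (auto intro: add_nonneg_pos)
      have "prob {\<omega> \<in> space M. a \<le> X \<omega> \<and> X \<omega> \<le> b} \<le> prob {\<omega> \<in> space M. \<bar>X \<omega> - (a + b) / 2\<bar> \<le> t}"
        using t by (intro finite_measure_mono) (auto simp: abs_le_iff field_simps)
      also have "\<dots> \<le> L * (2 * t)" by (rule lin[OF t(1)])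
      also have "\<dots> = L * (b - a) + 2 * L * u" by (simp add: t_def field_simps)
      also have "\<dots> \<le> L * (b - a) + e" using u by simp
      finally show ?thesis .
    qed
    then have "prob {\<omega> \<in> space M. a \<le> X \<omega> \<and> X \<omega> \<le> b} \<le> L * (b - a)" by (rule field_le_epsilon)
    moreover have "X -` {a..b} \<inter> space M = {\<omega> \<in> space M. a \<le> X \<omega> \<and> X \<omega> \<le> b}" by auto
    ultimately show ?thesis by (simp add: N_def emeasure_distr emeasure_eq_measure ennreal_leI)
  qed
  then have "emeasure N A \<le> ennreal L * emeasure lborel A" if "A \<in> sets borel" for A
    using that by (intro emeasure_le_lborel) (auto simp: L_def)
  then obtain f where [measurable]: "f \<in> borel_measurable borel" and f: "\<And>x. 0 \<le> f x" "\<And>x. f x \<le> L"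
      "N = density lborel (\<lambda>x. ennreal (f x))"
    using ex_bounded_density[of N L] N.finite_measure_axioms by (auto simp: L_def)
  have "distr M lborel X = N" unfolding N_def by (rule distr_cong) auto
  then have "bounded_density M X f"
    using f by (auto simp: bounded_density_def distributed_def intro!: bdd_aboveI[of _ L])
  then show "\<exists>f. bounded_density M X f" by blast
next
  interpret prob_space M by fact
  note X [measurable] = assms(2)
  fix f assume "bounded_density M X f"
  then have dens: "distributed M lborel X (\<lambda>x. ennreal (f x))" and f0: "\<And>x. 0 \<le> f x"
    and bdd: "bdd_above (range f)" by (auto simp: bounded_density_def)
  define N where "N = distr M borel X"
  have Nd: "N = density lborel (\<lambda>x. ennreal (f x))"
    using distributed_distr_eq_density[OF dens] unfolding N_def
    by (metis distr_cong sets_lborel)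
  have [measurable]: "(\<lambda>x. ennreal (f x)) \<in> borel_measurable borel"
    using distributed_borel_measurable[OF dens] by simp
  have NM: "emeasure N A = ennreal (prob {\<omega> \<in> space M. X \<omega> \<in> A})" if "A \<in> sets borel" for A
    using that by (auto simp: N_def emeasure_distr emeasure_eq_measure vimage_def Int_def conj_commute
      intro!: arg_cong[where f=prob])
  define L where "L = (SUP x. f x)"
  have fL: "f x \<le> L" for x unfolding L_def using bdd by (intro cSUP_upper) auto
  have L: "0 < L"
  proof (rule ccontr)
    assume "\<not> 0 < L"
    then have "f x = 0" for x using f0[of x] fL[of x] by linarith
    then have "emeasure N UNIV = 0" by (simp add: Nd emeasure_density)
    then show False using NM[of UNIV] by (simp add: prob_space)
  qed
  have le: "emeasure N A \<le> ennreal L * emeasure lborel A" if "A \<in> sets borel" for A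
  proof -
    have "emeasure N A = (\<integral>\<^sup>+ x. ennreal (f x) * indicator A x \<partial>lborel)"
      using that by (simp add: Nd emeasure_density)
    also have "\<dots> \<le> (\<integral>\<^sup>+ x. ennreal L * indicator A x \<partial>lborel)"
      using fL by (intro nn_integral_mono mult_right_mono ennreal_leI) auto
    also have "\<dots> = ennreal L * emeasure lborel A" using that by (simp add: nn_integral_cmult_indicator)
    finally show ?thesis .
  qed
  \<comment> \<open>Increments of the tail are masses of half-open intervals, so the supremum of the
    density is a Lipschitz constant, as \<open>min_slope_ge\<close> requires.\<close>
  have lip1: "0 \<le> upper_prob M X a - upper_prob M X b \<and> upper_prob M X a - upper_prob M X b \<le> L * (b - a)"
    if "a \<le> b" for a b
  proof -
    have "upper_prob M X a = upper_prob M X b + prob {\<omega> \<in> space M. X \<omega> \<in> {a..<b}}"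
      unfolding upper_prob_def using that
      by (subst finite_measure_Union[symmetric]) (auto intro!: arg_cong[where f=prob])
    moreover have "prob {\<omega> \<in> space M. X \<omega> \<in> {a..<b}} \<le> L * (b - a)"
    proof -
      have "ennreal (prob {\<omega> \<in> space M. X \<omega> \<in> {a..<b}}) \<le> ennreal (L * (b - a))"
        using NM[of "{a..<b}"] le[of "{a..<b}"] that L by (simp add: ennreal_mult)
      then show ?thesis using L that by simp
    qed
    ultimately show ?thesis by simp
  qed
  have lip: "\<bar>upper_prob M X a - upper_prob M X b\<bar> \<le> L * \<bar>a - b\<bar>" for a b
    using lip1[of a b] lip1[of b a] by (cases "a \<le> b") auto
  have slope: "1 / L \<le> min_slope M X K" for K by (rule min_slope_ge[OF X L lip])
  have "0 < 1 / L" using L by simp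
  then have d: "0 < min_slope M X K" for K using slope[of K] by linarith
  have D: "0 < inv_min_slope M X K" for K using d by (simp add: inv_min_slope_def)
  show "0 < inv_min_slope M X K" for K by (rule D)
  show "inv_min_slope M X K \<le> (SUP x. f x)" for K
    using slope[of K] d[of K] L unfolding L_def[symmetric] inv_min_slope_def by (simp add: field_simps)
  show "\<forall>Y \<in> borel_measurable M. \<forall>p>0.
           ennreal (indicator_error M K X Y)
             \<le> ennreal (3 * inv_min_slope M X K powr (p / (p + 1)))
               * ennreal_powr (Lp_norm M p (\<lambda>\<omega>. X \<omega> - Y \<omega>)) (p / (p + 1))" for K
  proof (intro ballI allI impI indicator_error_le X D)
    fix t :: real assume "0 < t"
    then show "prob {\<omega> \<in> space M. \<bar>X \<omega> - K\<bar> \<le> t} \<le> 2 * inv_min_slope M X K * t"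
      using min_slope_mult_prob_le[OF X, of t K] d[of K] by (simp add: inv_min_slope_def field_simps)
  qed auto
  have "absolutely_continuous lborel N"
    unfolding Nd by (rule absolutely_continuousI_density) simp
  \<comment> \<open>Almost every level satisfies the concentration hypothesis of
    \<open>indicator_error_exponent_optimal\<close>, with a constant \<open>c\<close> that may
    depend on the level.\<close>
  then have "AE x in N. \<exists>c>0. \<forall>\<delta>>0. \<exists>t. 0 < t \<and> t < \<delta> \<and> ennreal (c * t) \<le> emeasure N (cball x t)"
    by (intro AE_not_thin) (auto simp: N_def)
  then show "AE K in distr M borel X. \<forall>p>0. \<forall>q>p / (p + 1).
           \<not> (\<exists>C::real. \<forall>Y \<in> borel_measurable M.
                ennreal (indicator_error M K X Y)
                  \<le> ennreal C * ennreal_powr (Lp_norm M p (\<lambda>\<omega>. X \<omega> - Y \<omega>)) q)"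
    unfolding N_def[symmetric]
  proof eventually_elim
    case (elim K)
    have "emeasure N (cball K t) = ennreal (prob {\<omega> \<in> space M. \<bar>X \<omega> - K\<bar> \<le> t})" for t
      by (subst NM) (auto simp: dist_real_def abs_minus_commute)
    with elim obtain c where c: "0 < c"
      "\<And>\<delta>. 0 < \<delta> \<Longrightarrow> \<exists>t. 0 < t \<and> t < \<delta> \<and> c * t \<le> prob {\<omega> \<in> space M. \<bar>X \<omega> - K\<bar> \<le> t}"
      by auto
    show ?case using indicator_error_exponent_optimal[OF X _ _ c] by blast
  qed
qed

end
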